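(* Let $G$ be a countably infinite amenable group and let $(F_N)_{N=1}^\infty$ be a right-F\o lner sequence in $G$. Let $\mathcal{H}$ be a Hilbert space and let $u:G\to\mathcal{H}$ satisfy $\sup_{g\in G}\|u(g)\|<\infty$. If $$\lim_{N\rightarrow\infty}\frac{1}{|F_N|}\sum_{h\in F_N}\limsup_{M\rightarrow\infty}\left|\frac{1}{|F_M|}\sum_{g\in F_M}\langle u(gh),u(g)\rangle\right|=0,$$ then $u$ is nearly weakly mixing.
   Context: Groups are discrete; Hilbert spaces are complex and separable. A right-F\o lner sequence in $G$ is a sequence of finite sets $F_n\subseteq G$ with $\lim_n|F_n\triangle F_ng|/|F_n|=0$ for all $g\in G$; $G$ is amenable if it has one. $UB(\mathcal{H})$ is the set of $f:G\to\mathcal{H}$ with $\sup_g\|f(g)\|<\infty$. For $h\in G$ and $f:G\to\mathcal{H}$ put $(U_hf)(g)=f(gh)$. For a countable family $\{f_n\}_{n\in I}\subseteq UB(\mathcal{H})$ and an increasing sequence $(N_q)_{q=1}^\infty$ of positive integers, the pair $(\{f_n\}_{n\in I},(F_{N_q})_{q=1}^\infty)$ is a permissible pair if $\lim_{q\to\infty}\frac1{|F_{N_q}|}\sum_{g\in F_{N_q}}\langle x(g),y(g)\rangle$ exists for all $x,y\in\{f_n\}_{n\in I}$. A function $u\in UB(\mathcal{H})$ is nearly weakly mixing (relative to $(F_N)$) if for any $f\in UB(\mathcal{H})$ and any permissible pair $(\{U_gu,U_hf\}_{g,h\in G},(F_{N_q})_{q=1}^\infty)$ we have $$\lim_{N\rightarrow\infty}\frac{1}{|F_N|}\sum_{h\in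 F_N}\left|\lim_{q\rightarrow\infty}\frac{1}{|F_{N_q}|}\sum_{g\in F_{N_q}}\langle u(gh),f(g)\rangle\right|=0.$$ *)

theory Defs
  imports "HOL-Analysis.Analysis" "HOL-Algebra.Coset"
begin

text \<open>
  Complex inner product spaces, in the style of \<^class>\<open>real_inner\<close>. The inner product is linear in
  its first argument. The real scalar multiplication, the norm and the topology are those of
  \<^class>\<open>real_normed_vector\<close>, tied to the complex structure by \<open>scaleR_scaleC\<close> and
  \<open>norm_eq_sqrt_cinner\<close>.
\<close>

class complex_inner = real_normed_vector +
  fixes scaleC :: "complex \<Rightarrow> 'a \<Rightarrow> 'a"
    and cinner :: "'a \<Rightarrow> 'a \<Rightarrow> complex"
  assumes scaleC_add_right: "scaleC a (x + y) = scaleC a x + scaleC a y"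
    and scaleC_add_left: "scaleC (a + b) x = scaleC a x + scaleC b x"
    and scaleC_scaleC: "scaleC a (scaleC b x) = scaleC (a * b) x"
    and scaleC_one: "scaleC 1 x = x"
    and scaleR_scaleC: "scaleR r x = scaleC (complex_of_real r) x"
    and cinner_commute: "cinner x y = cnj (cinner y x)"
    and cinner_add_left: "cinner (x + y) z = cinner x z + cinner y z"
    and cinner_scaleC_left: "cinner (scaleC a x) y = a * cinner x y"
    and cinner_ge_zero: "0 \<le> Re (cinner x x)"
    and cinner_eq_zero_iff: "cinner x x = 0 \<longleftrightarrow> x = 0"
    and norm_eq_sqrt_cinner: "norm x = sqrt (Re (cinner x x))"

class complex_hilbert = complex_inner + complete_space

instantiation complex :: complex_hilbert
begin

definition scaleC_complex :: "complex \<Rightarrow> complex \<Rightarrow> complex"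
  where "scaleC_complex a x = a * x"

definition cinner_complex :: "complex \<Rightarrow> complex \<Rightarrow> complex"
  where "cinner_complex x y = x * cnj y"

instance
  by standard
    (auto simp: scaleC_complex_def cinner_complex_def algebra_simps scaleR_conv_of_real
      norm_complex_def power2_eq_square)

end

text \<open>
  Groups are given by a carrier, and a map defined on the group is a HOL function of which only the
  values on the carrier matter. Sequences are indexed from 0.
\<close>

text \<open>
  The sets of a Folner sequence have to be nonempty explicitly: for an empty set the quotient below
  would be \<open>0 / 0 = 0\<close>.
\<close>

definition right_Folner :: "('g, 'b) monoid_scheme \<Rightarrow> (nat \<Rightarrow> 'g set) \<Rightarrow> bool"
  where "right_Folner G F \<longleftrightarrow>
    (\<forall>n. finite (F n) \<and> F n \<noteq> {} \<and> F n \<subseteq> carrier G) \<and>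
    (\<forall>g\<in>carrier G.
      (\<lambda>n. real (card (sym_diff (F n) (F n #>\<^bsub>G\<^esub> g))) / real (card (F n))) \<longlonglongrightarrow> 0)"

definition amenable :: "('g, 'b) monoid_scheme \<Rightarrow> bool"
  where "amenable G \<longleftrightarrow> (\<exists>F. right_Folner G F)"

definition UB :: "('g, 'b) monoid_scheme \<Rightarrow> ('g \<Rightarrow> 'h::complex_inner) set"
  where "UB G = {f. bdd_above ((\<lambda>g. norm (f g)) ` carrier G)}"

definition shift :: "('g, 'b) monoid_scheme \<Rightarrow> 'g \<Rightarrow> ('g \<Rightarrow> 'h) \<Rightarrow> 'g \<Rightarrow> 'h"
  where "shift G h f = (\<lambda>g. f (g \<otimes>\<^bsub>G\<^esub> h))"

definition average :: "'g set \<Rightarrow> ('g \<Rightarrow> 'a::real_vector) \<Rightarrow> 'a"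
  where "average A \<phi> = (1 / real (card A)) *\<^sub>R (\<Sum>g\<in>A. \<phi> g)"

text \<open>
  The countable family is represented by the set \<open>A\<close> of its members; the subsequence
  $(F_{N_q})_q$ by its strictly increasing sequence of indices \<open>N\<close>.
\<close>

definition permissible_pair ::
    "('g, 'b) monoid_scheme \<Rightarrow> (nat \<Rightarrow> 'g set) \<Rightarrow> ('g \<Rightarrow> 'h::complex_inner) set \<Rightarrow> (nat \<Rightarrow> nat) \<Rightarrow> bool"
  where "permissible_pair G F A N \<longleftrightarrow>
    countable A \<and> A \<subseteq> UB G \<and> strict_mono N \<and>
    (\<forall>x\<in>A. \<forall>y\<in>A. convergent (\<lambda>q. average (F (N q)) (\<lambda>g. cinner (x g) (y g))))"

definition nearly_weakly_mixing ::
    "('g, 'b) monoid_scheme \<Rightarrow> (nat \<Rightarrow> 'g set) \<Rightarrow> ('g \<Rightarrow> 'h::complex_inner) \<Rightarrow> bool"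
  where "nearly_weakly_mixing G F u \<longleftrightarrow>
    u \<in> UB G \<and>
    (\<forall>f\<in>UB G. \<forall>N.
      permissible_pair G F
        ((\<lambda>g. shift G g u) ` carrier G \<union> (\<lambda>h. shift G h f) ` carrier G) N \<longrightarrow>
      (\<lambda>n. average (F n) (\<lambda>h. cmod
        (lim (\<lambda>q. average (F (N q)) (\<lambda>g. cinner (u (g \<otimes>\<^bsub>G\<^esub> h)) (f g)))))) \<longlonglongrightarrow> 0)"

end

theory Submission
  imports Defs
begin

text \<open>
  Let $\gamma(h)$ and $c(h)$ be the limits along the given subsequence of the averages of
  $\langle u(gh),u(g)\rangle$ and $\langle u(gh),f(g)\rangle$. The averages of $|\gamma|$ tend to
  0, so one finds $k_1,\dots,k_m$ with all $|\gamma(k_j^{-1}k_i)|$, $i\ne j$, small. By invariance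
  the translates of $u$ by $hk_1,\dots,hk_m$ are then almost orthogonal for every $h$, and Bessel's
  inequality makes $\frac1m\sum_i|c(hk_i)|$ small uniformly in $h$. Since $F$ is right-Folner, its
  average over $h$ agrees asymptotically with that of $|c|$.
\<close>

section \<open>Sesquilinearity of the inner product and the Cauchy-Schwarz inequality\<close>

lemma cinner_add_right:
  fixes x :: "'a::complex_inner"
  shows "cinner x (y + z) = cinner x y + cinner x z"
  by (metis cinner_add_left cinner_commute complex_cnj_add)

lemma cinner_scaleC_right:
  fixes x :: "'a::complex_inner"
  shows "cinner x (scaleC a y) = cnj a * cinner x y"
  by (metis cinner_commute cinner_scaleC_left complex_cnj_mult)

lemma cinner_zero_left [simp]: "cinner 0 (x :: 'a::complex_inner) = 0"
  using cinner_add_left[of 0 0 x] by simp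

lemma cinner_zero_right [simp]: "cinner (x :: 'a::complex_inner) 0 = 0"
  using cinner_add_right[of x 0 0] by simp

lemma cinner_sum_left:
  fixes y :: "'a::complex_inner"
  shows "cinner (\<Sum>i\<in>I. x i) y = (\<Sum>i\<in>I. cinner (x i) y)"
  by (induction I rule: infinite_finite_induct) (auto simp: cinner_add_left)

lemma cinner_sum_right:
  fixes x :: "'a::complex_inner"
  shows "cinner x (\<Sum>i\<in>I. y i) = (\<Sum>i\<in>I. cinner x (y i))"
  by (induction I rule: infinite_finite_induct) (auto simp: cinner_add_right)

lemma cinner_self: "cinner x x = of_real ((norm (x :: 'a::complex_inner))\<^sup>2)"
proof -
  have "Im (cinner x x) = 0"
    using arg_cong[OF cinner_commute[of x x], of Im] by simp
  then show ?thesis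
    by (simp add: complex_eq_iff norm_eq_sqrt_cinner cinner_ge_zero)
qed

lemma cmod_cinner_le:
  fixes x y :: "'a::complex_inner"
  shows "cmod (cinner x y) \<le> norm x * norm y"
proof (cases "y = 0")
  case False
  define a where "a = cinner x y"
  define n where "n = (norm y)\<^sup>2"
  have n: "n > 0"
    using False by (simp add: n_def)
  have yx: "cinner y x = cnj a"
    unfolding a_def by (rule cinner_commute)
  have aa: "a * cnj a = of_real ((cmod a)\<^sup>2)"
    by (rule complex_norm_square[symmetric])
  \<comment> \<open>Up to the factor \<open>n\<close>, this is the component of \<open>x\<close>
    orthogonal to \<open>y\<close>; the scaling avoids dividing by \<open>n\<close>. Nonnegativity
    of \<open>cinner z z\<close> is then the claimed inequality multiplied by
    \<open>n\<close>.\<close>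
  define z where "z = scaleC (of_real n) x + scaleC (- a) y"
  have "cinner z z = of_real n * (of_real n * of_real ((norm x)\<^sup>2)) - of_real n * (a * cnj a)"
    unfolding z_def cinner_add_left cinner_add_right cinner_scaleC_left cinner_scaleC_right
      yx a_def[symmetric] cinner_self[of x] cinner_self[of y] n_def[symmetric]
    by (simp add: algebra_simps)
  also have "\<dots> = of_real (n * (n * (norm x)\<^sup>2 - (cmod a)\<^sup>2))"
    unfolding aa by (simp add: algebra_simps)
  finally have "0 \<le> n * (n * (norm x)\<^sup>2 - (cmod a)\<^sup>2)"
    using cinner_ge_zero[of z] by simp
  then have "(cmod a)\<^sup>2 \<le> n * (norm x)\<^sup>2"
    using n by (simp add: zero_le_mult_iff)
  then have "(cmod a)\<^sup>2 \<le> (norm x * norm y)\<^sup>2"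
    by (simp add: n_def power_mult_distrib mult.commute)
  then show ?thesis
    unfolding a_def by (rule power2_le_imp_le) simp
qed simp

section \<open>Averages over finite sets, leading to a Bessel-type inequality\<close>

lemma average_cong: "(\<And>g. g \<in> A \<Longrightarrow> \<phi> g = \<psi> g) \<Longrightarrow> average A \<phi> = average A \<psi>"
  by (simp add: average_def)

lemma average_sum: "average A (\<lambda>g. \<Sum>i\<in>I. \<phi> i g) = (\<Sum>i\<in>I. average A (\<phi> i))"
  unfolding average_def by (subst sum.swap) (simp add: scaleR_sum_right)

lemma average_mult_left:
  fixes a :: "'a::real_algebra"
  shows "average A (\<lambda>g. a * \<phi> g) = a * average A \<phi>"
  by (simp add: average_def sum_distrib_left)

lemma average_cnj: "average A (\<lambda>g. cnj (\<phi> g)) = cnj (average A \<phi>)"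
  by (simp add: average_def)

lemma average_of_real: "average A (\<lambda>g. of_real (\<phi> g) :: complex) = of_real (average A \<phi>)"
  by (simp add: average_def scaleR_conv_of_real)

lemma average_mono:
  fixes \<phi> \<psi> :: "'g \<Rightarrow> real"
  shows "(\<And>g. g \<in> A \<Longrightarrow> \<phi> g \<le> \<psi> g) \<Longrightarrow> average A \<phi> \<le> average A \<psi>"
  by (auto simp: average_def intro!: divide_right_mono sum_mono)

lemma average_const: "finite A \<Longrightarrow> A \<noteq> {} \<Longrightarrow> average A (\<lambda>_. c) = c"
  by (simp add: average_def sum_constant_scaleR)

lemma norm_average_le: "norm (average A \<phi>) \<le> average A (\<lambda>g. norm (\<phi> g))"
  by (auto simp: average_def norm_sum intro!: divide_right_mono)

lemma norm_average_le_const: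
  assumes "finite A" "A \<noteq> {}" "\<And>g. g \<in> A \<Longrightarrow> norm (\<phi> g) \<le> c"
  shows "norm (average A \<phi>) \<le> c"
  using norm_average_le[of A \<phi>] average_mono[of A "\<lambda>g. norm (\<phi> g)" "\<lambda>_. c"]
    average_const[of A c] assms by simp

lemma average_power2_le:
  fixes \<phi> :: "'g \<Rightarrow> real"
  shows "(average A \<phi>)\<^sup>2 \<le> average A (\<lambda>g. (\<phi> g)\<^sup>2)"
\<comment> \<open>The case of cardinality 0 includes infinite \<open>A\<close>; both sides are then
  0 because \<open>1 / 0 = 0\<close>.\<close>
proof (cases "card A = 0")
  case False
  have "(\<Sum>g\<in>A. \<phi> g)\<^sup>2 \<le> (\<Sum>g\<in>A. (\<phi> g)\<^sup>2) * real (card A)"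
    by (rule sum_squared_le_sum_of_squares)
  then show ?thesis
    using False by (simp add: average_def power_divide field_simps power2_eq_square)
qed (simp add: average_def)

text \<open>Bessel's inequality by duality: combine the \<open>x i\<close> into one function
  \<open>v\<close> whose correlation with \<open>f\<close> is the sum of all
  \<open>cmod (c i)\<close>, and apply Cauchy-Schwarz to \<open>v\<close> and \<open>f\<close>. No
  orthogonality is assumed; its failure is measured by the off-diagonal entries of the limiting Gram
  matrix \<open>B\<close>.\<close>

lemma bessel_average_le:
  fixes x :: "'i \<Rightarrow> 'g \<Rightarrow> 'h::complex_inner" and f :: "'g \<Rightarrow> 'h"
  assumes f: "\<And>q g. g \<in> E q \<Longrightarrow> norm (f g) \<le> D"
    and lim_c: "\<And>i. i \<in> I \<Longrightarrow> (\<lambda>q. average (E q) (\<lambda>g. cinner (x i g) (f g))) \<longlonglongrightarrow> c i"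
    and lim_B: "\<And>i j. i \<in> I \<Longrightarrow> j \<in> I \<Longrightarrow>
      (\<lambda>q. average (E q) (\<lambda>g. cinner (x i g) (x j g))) \<longlonglongrightarrow> B i j"
  shows "(\<Sum>i\<in>I. cmod (c i))\<^sup>2 \<le> D\<^sup>2 * (\<Sum>i\<in>I. \<Sum>j\<in>I. cmod (B i j))"
proof -
  \<comment> \<open>Multiplication by \<open>a i\<close> rotates \<open>c i\<close> onto the
    nonnegative real axis. Where \<open>c i = 0\<close> the coefficient is 0, so its modulus is only
    bounded by 1.\<close>
  define a where "a i = cnj (sgn (c i))" for i
  have a: "a i * c i = of_real (cmod (c i))" "cmod (a i) \<le> 1" for i
  proof -
    show "a i * c i = of_real (cmod (c i))"
    proof (cases "c i = 0")
      case False
      have "c i * cnj (c i) = of_real (cmod (c i)) * of_real (cmod (c i))"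
        using complex_norm_square[of "c i"] by (simp add: power2_eq_square)
      with False show ?thesis
        by (simp add: a_def sgn_eq mult.commute)
    qed (simp add: a_def)
    show "cmod (a i) \<le> 1"
      by (simp add: a_def norm_sgn)
  qed
  define v where "v g = (\<Sum>i\<in>I. scaleC (a i) (x i g))" for g
  define S where "S = (\<Sum>i\<in>I. \<Sum>j\<in>I. a i * (cnj (a j) * B i j))"
  have "average (E q) (\<lambda>g. cinner (v g) (f g))
      = (\<Sum>i\<in>I. a i * average (E q) (\<lambda>g. cinner (x i g) (f g)))" for q
    unfolding v_def cinner_sum_left cinner_scaleC_left average_sum average_mult_left ..
  moreover have "(\<lambda>q. \<Sum>i\<in>I. a i * average (E q) (\<lambda>g. cinner (x i g) (f g)))
      \<longlonglongrightarrow> (\<Sum>i\<in>I. a i * c i)"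
    by (intro tendsto_sum tendsto_mult tendsto_const lim_c)
  ultimately have vf: "(\<lambda>q. average (E q) (\<lambda>g. cinner (v g) (f g))) \<longlonglongrightarrow> of_real (\<Sum>i\<in>I. cmod (c i))"
    by (simp add: a)
  have "complex_of_real (average (E q) (\<lambda>g. (norm (v g))\<^sup>2))
      = (\<Sum>i\<in>I. \<Sum>j\<in>I. a i * (cnj (a j) * average (E q) (\<lambda>g. cinner (x i g) (x j g))))" for q
    unfolding average_of_real[symmetric] cinner_self[symmetric] v_def cinner_sum_left cinner_sum_right
      cinner_scaleC_left cinner_scaleC_right average_sum average_mult_left sum_distrib_left
    by (subst sum.swap) (simp add: mult.left_commute)
  moreover have "(\<lambda>q. \<Sum>i\<in>I. \<Sum>j\<in>I.
      a i * (cnj (a j) * average (E q) (\<lambda>g. cinner (x i g) (x j g)))) \<longlonglongrightarrow> S"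
    unfolding S_def by (intro tendsto_sum tendsto_mult tendsto_const lim_B)
  ultimately have "(\<lambda>q. complex_of_real (average (E q) (\<lambda>g. (norm (v g))\<^sup>2))) \<longlonglongrightarrow> S"
    by simp
  then have vv: "(\<lambda>q. average (E q) (\<lambda>g. (norm (v g))\<^sup>2)) \<longlonglongrightarrow> Re S"
    using tendsto_Re by fastforce
  \<comment> \<open>Cauchy-Schwarz is used twice, in the Hilbert space at each \<open>g\<close> and
    then over the averaging set. The bound holds for each \<open>q\<close> and so passes to the
    limit.\<close>
  have "(cmod (average (E q) (\<lambda>g. cinner (v g) (f g))))\<^sup>2 \<le> D\<^sup>2 * average (E q) (\<lambda>g. (norm (v g))\<^sup>2)" for q
  proof -
    have "cmod (cinner (v g) (f g)) \<le> norm (v g) * D" if "g \<in> E q" for g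
      using cmod_cinner_le[of "v g" "f g"] mult_left_mono[OF f[OF that], of "norm (v g)"] by simp
    then have "(cmod (cinner (v g) (f g)))\<^sup>2 \<le> D\<^sup>2 * (norm (v g))\<^sup>2" if "g \<in> E q" for g
      using power_mono[of "cmod (cinner (v g) (f g))" "norm (v g) * D" 2] that
      by (simp add: power_mult_distrib mult.commute)
    then have "average (E q) (\<lambda>g. (cmod (cinner (v g) (f g)))\<^sup>2) \<le> average (E q) (\<lambda>g. D\<^sup>2 * (norm (v g))\<^sup>2)"
      by (rule average_mono)
    moreover have "(cmod (average (E q) (\<lambda>g. cinner (v g) (f g))))\<^sup>2
        \<le> (average (E q) (\<lambda>g. cmod (cinner (v g) (f g))))\<^sup>2"
      by (intro power_mono norm_average_le norm_ge_zero)
    ultimately show ?thesis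
      using average_power2_le[of "E q" "\<lambda>g. cmod (cinner (v g) (f g))"]
      by (simp add: average_mult_left)
  qed
  then have "(cmod (of_real (\<Sum>i\<in>I. cmod (c i))))\<^sup>2 \<le> D\<^sup>2 * Re S"
    by (intro LIMSEQ_le[OF tendsto_power[OF tendsto_norm[OF vf]] tendsto_mult[OF tendsto_const vv]]) auto
  then have "(\<Sum>i\<in>I. cmod (c i))\<^sup>2 \<le> D\<^sup>2 * Re S"
    by (simp only: norm_of_real power2_abs)
  also have "Re S \<le> (\<Sum>i\<in>I. \<Sum>j\<in>I. cmod (B i j))"
  proof -
    have "cmod (a i * (cnj (a j) * B i j)) \<le> cmod (B i j)" for i j
      using mult_mono[OF a(2)[of i] mult_mono[OF a(2)[of j] order_refl[of "cmod (B i j)"]]]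
      by (simp add: norm_mult)
    then have "cmod S \<le> (\<Sum>i\<in>I. \<Sum>j\<in>I. cmod (B i j))"
      unfolding S_def by (intro sum_norm_le order_trans[OF norm_sum] sum_mono)
    then show ?thesis
      using complex_Re_le_cmod[of S] by linarith
  qed
  finally show ?thesis
    by (simp add: mult_left_mono)
qed

section \<open>Averages along a right-Folner sequence\<close>

text \<open>Right multiplication by \<open>k\<close> is injective, so the first sum is the sum of
  \<open>\<phi>\<close> over the translated set. The two sums differ only on the symmetric
  difference, where each term is at most \<open>C\<close>, and the Folner condition makes that set
  negligible.\<close>

lemma right_Folner_average_translate:
  fixes \<phi> :: "'g \<Rightarrow> 'a::real_normed_vector"
  assumes G: "group G" and F: "right_Folner G F"
    and k: "k \<in> carrier G" and \<phi>: "\<And>g. g \<in> carrier G \<Longrightarrow> norm (\<phi> g) \<le> C"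
  shows "(\<lambda>n. average (F n) (\<lambda>g. \<phi> (g \<otimes>\<^bsub>G\<^esub> k)) - average (F n) \<phi>) \<longlonglongrightarrow> 0"
proof -
  interpret group G by (rule G)
  have fin: "finite (F n)" and sub: "F n \<subseteq> carrier G" for n
    using F by (auto simp: right_Folner_def)
  define E where "E n = F n #>\<^bsub>G\<^esub> k" for n
  have E_image: "E n = (\<lambda>g. g \<otimes>\<^bsub>G\<^esub> k) ` F n" for n
    by (auto simp: E_def r_coset_def)
  have finE: "finite (E n)" and subE: "E n \<subseteq> carrier G" for n
    using fin sub k by (auto simp: E_image)
  have "inj_on (\<lambda>g. g \<otimes>\<^bsub>G\<^esub> k) (F n)" for n
    by (rule inj_onI) (use k right_cancel subsetD[OF sub] in blast)
  then have sumE: "(\<Sum>g\<in>F n. \<phi> (g \<otimes>\<^bsub>G\<^esub> k)) = sum \<phi> (E n)" for n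
    by (simp add: E_image sum.reindex)
  have "norm (sum \<phi> (E n) - sum \<phi> (F n)) \<le> real (card (sym_diff (F n) (E n))) * C" for n
  proof -
    have "norm (sum \<phi> (E n) - sum \<phi> (F n)) = norm (sum \<phi> (E n - F n) - sum \<phi> (F n - E n))"
      using sum.Int_Diff[OF finE, of \<phi> n "F n"] sum.Int_Diff[OF fin, of \<phi> n "E n"]
      by (simp add: Int_commute)
    also have "\<dots> \<le> norm (sum \<phi> (E n - F n)) + norm (sum \<phi> (F n - E n))"
      by (rule norm_triangle_ineq4)
    also have "\<dots> \<le> real (card (E n - F n)) * C + real (card (F n - E n)) * C"
      by (intro add_mono sum_norm_bound \<phi>) (use sub subE in auto)
    also have "\<dots> = real (card (sym_diff (F n) (E n))) * C"
      by (subst card_Un_disjoint) (auto simp: fin finE algebra_simps)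
    finally show ?thesis .
  qed
  then have "norm (average (F n) (\<lambda>g. \<phi> (g \<otimes>\<^bsub>G\<^esub> k)) - average (F n) \<phi>)
      \<le> real (card (sym_diff (F n) (E n))) / real (card (F n)) * C" for n
    by (simp add: average_def sumE flip: scaleR_diff_right)
       (metis divide_right_mono of_nat_0_le_iff)
  moreover have "(\<lambda>n. real (card (sym_diff (F n) (E n))) / real (card (F n)) * C) \<longlonglongrightarrow> 0"
    by (rule tendsto_mult_left_zero) (use F k in \<open>simp add: right_Folner_def E_def\<close>)
  ultimately show ?thesis
    by (rule Lim_null_comparison[OF always_eventually, OF allI])
qed

text \<open>This comparison serves in both directions: it carries small averages of a function over
  to the sum of its translates, and a bound on that sum back to the function.\<close>

lemma right_Folner_average_sum_translates:
  fixes \<phi> :: "'g \<Rightarrow> real"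
  assumes G: "group G" and F: "right_Folner G F"
    and k: "\<And>i. i < m \<Longrightarrow> k i \<in> carrier G"
    and \<phi>: "\<And>g. g \<in> carrier G \<Longrightarrow> norm (\<phi> g) \<le> C"
  shows "(\<lambda>n. average (F n) (\<lambda>g. \<Sum>i<m. \<phi> (g \<otimes>\<^bsub>G\<^esub> k i)) - real m * average (F n) \<phi>) \<longlonglongrightarrow> 0"
proof -
  have "(\<lambda>n. \<Sum>i<m. average (F n) (\<lambda>g. \<phi> (g \<otimes>\<^bsub>G\<^esub> k i)) - average (F n) \<phi>) \<longlonglongrightarrow> (\<Sum>i<m. 0)"
    by (intro tendsto_sum right_Folner_average_translate[OF G F _ \<phi>] k) auto
  then show ?thesis
    by (simp add: average_sum sum_subtractf)
qed

text \<open>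
  Since \<open>F\<close> is a right-Folner sequence, only right translates of \<open>p\<close> are negligible; so the new
  element is found as the inverse of some \<open>x\<close> for which all \<open>p (x \<otimes> k i)\<close> are small.
\<close>

lemma right_Folner_exists_separated:
  fixes p :: "'g \<Rightarrow> real"
  assumes G: "group G" and F: "right_Folner G F"
    and p: "\<And>g. g \<in> carrier G \<Longrightarrow> 0 \<le> p g" "\<And>g. g \<in> carrier G \<Longrightarrow> p g \<le> C"
    and lim: "(\<lambda>n. average (F n) p) \<longlonglongrightarrow> 0" and \<delta>: "0 < \<delta>"
  shows "\<exists>k :: nat \<Rightarrow> 'g. (\<forall>i<m. k i \<in> carrier G) \<and>
    (\<forall>j<m. \<forall>i<j. p (inv\<^bsub>G\<^esub> k j \<otimes>\<^bsub>G\<^esub> k i) < \<delta>)"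
proof (induction m)
  case (Suc m)
  interpret group G by (rule G)
  have F': "finite (F n)" "F n \<noteq> {}" "F n \<subseteq> carrier G" for n
    using F by (auto simp: right_Folner_def)
  obtain k where k: "\<And>i. i < m \<Longrightarrow> k i \<in> carrier G"
    and sep: "\<And>i j. j < m \<Longrightarrow> i < j \<Longrightarrow> p (inv\<^bsub>G\<^esub> k j \<otimes>\<^bsub>G\<^esub> k i) < \<delta>"
    using Suc by blast
  have "(\<lambda>n. average (F n) (\<lambda>g. \<Sum>i<m. p (g \<otimes>\<^bsub>G\<^esub> k i)) - real m * average (F n) p) \<longlonglongrightarrow> 0"
    using p by (intro right_Folner_average_sum_translates[OF G F, where C = C] k) auto
  from tendsto_add[OF this tendsto_mult_right_zero[OF lim, of "real m"]]
  have "(\<lambda>n. average (F n) (\<lambda>g. \<Sum>i<m. p (g \<otimes>\<^bsub>G\<^esub> k i))) \<longlonglongrightarrow> 0"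
    by simp
  from order_tendstoD(2)[OF this \<delta>]
  obtain n where n: "average (F n) (\<lambda>g. \<Sum>i<m. p (g \<otimes>\<^bsub>G\<^esub> k i)) < \<delta>"
    by (auto simp: eventually_sequentially)
  \<comment> \<open>An average below \<open>\<delta>\<close> forces some value below
    \<open>\<delta>\<close>. As \<open>p\<close> is nonnegative, smallness of the sum at that
    \<open>x\<close> gives smallness of all \<open>m\<close> terms at once.\<close>
  have "\<exists>x\<in>F n. (\<Sum>i<m. p (x \<otimes>\<^bsub>G\<^esub> k i)) < \<delta>"
  proof (rule ccontr)
    assume "\<not> ?thesis"
    then have "average (F n) (\<lambda>_. \<delta>) \<le> average (F n) (\<lambda>g. \<Sum>i<m. p (g \<otimes>\<^bsub>G\<^esub> k i))"
      by (intro average_mono) auto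
    then show False
      using n F' by (simp add: average_const)
  qed
  then obtain x where x: "x \<in> carrier G" "(\<Sum>i<m. p (x \<otimes>\<^bsub>G\<^esub> k i)) < \<delta>"
    using F' by blast
  have "p (x \<otimes>\<^bsub>G\<^esub> k i) < \<delta>" if "i < m" for i
    using member_le_sum[of i "{..<m}" "\<lambda>i. p (x \<otimes>\<^bsub>G\<^esub> k i)"] that x k p by force
  then show ?case
    using k sep x by (intro exI[of _ "k(m := inv\<^bsub>G\<^esub> x)"]) (auto simp: less_Suc_eq)
qed auto

text \<open>Averaging over \<open>F n\<close> asymptotically ignores right translations, so the
  average of \<open>\<phi>\<close> is nearly the average over \<open>h\<close> of the mean of
  \<open>\<phi>\<close> on the points \<open>h k_i\<close>. A bound on that mean uniform in
  \<open>h\<close> therefore suffices, and the points may depend on the accuracy wanted.\<close>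

lemma right_Folner_average_tendsto_0:
  fixes \<phi> :: "'g \<Rightarrow> real"
  assumes G: "group G" and F: "right_Folner G F"
    and \<phi>: "\<And>g. g \<in> carrier G \<Longrightarrow> 0 \<le> \<phi> g" "\<And>g. g \<in> carrier G \<Longrightarrow> \<phi> g \<le> C"
    and small: "\<And>\<epsilon>. 0 < \<epsilon> \<Longrightarrow> \<exists>m k. 0 < m \<and> (\<forall>i<m. k i \<in> carrier G) \<and>
      (\<forall>h\<in>carrier G. (\<Sum>i<m. \<phi> (h \<otimes>\<^bsub>G\<^esub> k i)) \<le> real m * \<epsilon>)"
  shows "(\<lambda>n. average (F n) \<phi>) \<longlonglongrightarrow> 0"
proof (rule tendstoI)
  fix \<epsilon> :: real assume \<epsilon>: "0 < \<epsilon>"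
  have F': "finite (F n)" "F n \<noteq> {}" "F n \<subseteq> carrier G" for n
    using F by (auto simp: right_Folner_def)
  \<comment> \<open>Half of \<open>\<epsilon>\<close> bounds the mean over the translates; the other
    half absorbs the error of replacing each translate by \<open>\<phi>\<close>.\<close>
  obtain m and k :: "nat \<Rightarrow> 'g" where m: "0 < m" and k: "\<And>i. i < m \<Longrightarrow> k i \<in> carrier G"
    and le: "\<And>h. h \<in> carrier G \<Longrightarrow> (\<Sum>i<m. \<phi> (h \<otimes>\<^bsub>G\<^esub> k i)) \<le> real m * (\<epsilon> / 2)"
    using small[of "\<epsilon> / 2"] \<epsilon> by auto
  have "(\<lambda>n. average (F n) (\<lambda>g. \<Sum>i<m. \<phi> (g \<otimes>\<^bsub>G\<^esub> k i)) - real m * average (F n) \<phi>) \<longlonglongrightarrow> 0"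
    using \<phi> by (intro right_Folner_average_sum_translates[OF G F, where C = C] k) auto
  then have "\<forall>\<^sub>F n in sequentially. average (F n) (\<lambda>g. \<Sum>i<m. \<phi> (g \<otimes>\<^bsub>G\<^esub> k i)) - real m * average (F n) \<phi>
      > - (real m * (\<epsilon> / 2))"
    by (rule order_tendstoD) (use m \<epsilon> in auto)
  then show "\<forall>\<^sub>F n in sequentially. dist (average (F n) \<phi>) 0 < \<epsilon>"
  proof (rule eventually_mono)
    fix n
    assume *: "average (F n) (\<lambda>g. \<Sum>i<m. \<phi> (g \<otimes>\<^bsub>G\<^esub> k i)) - real m * average (F n) \<phi> > - (real m * (\<epsilon> / 2))"
    have "average (F n) (\<lambda>g. \<Sum>i<m. \<phi> (g \<otimes>\<^bsub>G\<^esub> k i)) \<le> average (F n) (\<lambda>_. real m * (\<epsilon> / 2))"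
      using F' by (intro average_mono le) auto
    then have "real m * average (F n) \<phi> < real m * \<epsilon>"
      using * F'[of n] by (simp add: average_const)
    moreover have "average (F n) (\<lambda>_. 0) \<le> average (F n) \<phi>"
      using F' by (intro average_mono \<phi>) auto
    ultimately show "dist (average (F n) \<phi>) 0 < \<epsilon>"
      using m F'[of n] by (simp add: average_const)
  qed
qed

section \<open>Bounded functions and the limits of their correlations along a permissible
  pair\<close>

lemma UB_bound:
  assumes "f \<in> UB G"
  obtains C where "0 \<le> C" "\<And>g. g \<in> carrier G \<Longrightarrow> norm (f g) \<le> C"
proof -
  obtain C where "\<forall>g\<in>carrier G. norm (f g) \<le> C"
    using assms by (auto simp: UB_def bdd_above_def)
  then show thesis
    using that[of "max 0 C"] by force
qed

theorem theorem3p3: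
  fixes G :: "('g, 'b) monoid_scheme"
    and F :: "nat \<Rightarrow> 'g set"
    and u :: "'g \<Rightarrow> 'h::complex_hilbert"
  assumes "group G"
    and "countable (carrier G)" and "infinite (carrier G)"
    and "amenable G"
    and "right_Folner G F"
    and "separable_space (euclidean :: 'h topology)"
    and "u \<in> UB G"
    and "(\<lambda>N. (\<Sum>h\<in>F N. limsup (\<lambda>M. ereal (cmod
            (average (F M) (\<lambda>g. cinner (u (g \<otimes>\<^bsub>G\<^esub> h)) (u g))))))
          / ereal (real (card (F N)))) \<longlonglongrightarrow> 0"
  shows "nearly_weakly_mixing G F u"
  unfolding nearly_weakly_mixing_def
proof (intro conjI ballI allI impI)
  interpret group G by fact
  note F = \<open>right_Folner G F\<close>
  have F': "finite (F n)" "F n \<noteq> {}" "F n \<subseteq> carrier G" for n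
    using F by (auto simp: right_Folner_def)
  have F_carrier: "g \<in> carrier G" if "g \<in> F n" for g n
    using F'(3) that by blast
  show "u \<in> UB G" by fact
  fix f :: "'g \<Rightarrow> 'h" and N
  assume "f \<in> UB G"
    and perm: "permissible_pair G F
        ((\<lambda>g. shift G g u) ` carrier G \<union> (\<lambda>h. shift G h f) ` carrier G) N"
  obtain C where C: "0 \<le> C" "\<And>g. g \<in> carrier G \<Longrightarrow> norm (u g) \<le> C"
    using UB_bound[OF \<open>u \<in> UB G\<close>] by blast
  obtain D where D: "0 \<le> D" "\<And>g. g \<in> carrier G \<Longrightarrow> norm (f g) \<le> D"
    using UB_bound[OF \<open>f \<in> UB G\<close>] by blast
  have N: "strict_mono N"
    using perm by (simp add: permissible_pair_def)

  define \<gamma> where "\<gamma> h = lim (\<lambda>q. average (F (N q)) (\<lambda>g. cinner (u (g \<otimes>\<^bsub>G\<^esub> h)) (u g)))" for h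
  define c where "c h = lim (\<lambda>q. average (F (N q)) (\<lambda>g. cinner (u (g \<otimes>\<^bsub>G\<^esub> h)) (f g)))" for h

  have lim_c: "(\<lambda>q. average (F (N q)) (\<lambda>g. cinner (u (g \<otimes>\<^bsub>G\<^esub> h)) (f g))) \<longlonglongrightarrow> c h"
    if "h \<in> carrier G" for h
  proof -
    \<comment> \<open>The permissible family contains \<open>f\<close> as its shift by the identity,
      which agrees with \<open>f\<close> on the carrier.\<close>
    have "convergent (\<lambda>q. average (F (N q)) (\<lambda>g. cinner (shift G h u g) (shift G \<one>\<^bsub>G\<^esub> f g)))"
      using perm that by (auto simp: permissible_pair_def)
    moreover have "average (F (N q)) (\<lambda>g. cinner (shift G h u g) (shift G \<one>\<^bsub>G\<^esub> f g))
        = average (F (N q)) (\<lambda>g. cinner (u (g \<otimes>\<^bsub>G\<^esub> h)) (f g))" for q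
      by (intro average_cong) (simp add: shift_def F_carrier)
    ultimately show ?thesis
      by (simp add: c_def convergent_LIMSEQ_iff)
  qed
  have lim_\<gamma>: "(\<lambda>q. average (F (N q)) (\<lambda>g. cinner (u (g \<otimes>\<^bsub>G\<^esub> h)) (u g))) \<longlonglongrightarrow> \<gamma> h"
    if "h \<in> carrier G" for h
  proof -
    have "convergent (\<lambda>q. average (F (N q)) (\<lambda>g. cinner (shift G h u g) (shift G \<one>\<^bsub>G\<^esub> u g)))"
      using perm that by (auto simp: permissible_pair_def)
    moreover have "average (F (N q)) (\<lambda>g. cinner (shift G h u g) (shift G \<one>\<^bsub>G\<^esub> u g))
        = average (F (N q)) (\<lambda>g. cinner (u (g \<otimes>\<^bsub>G\<^esub> h)) (u g))" for q
      by (intro average_cong) (simp add: shift_def F_carrier)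
    ultimately show ?thesis
      by (simp add: \<gamma>_def convergent_LIMSEQ_iff)
  qed
  have uu: "cmod (cinner (u g) (u h)) \<le> C * C" if "g \<in> carrier G" "h \<in> carrier G" for g h
    using cmod_cinner_le[of "u g" "u h"] mult_mono[OF C(2)[OF that(1)] C(2)[OF that(2)]] C(1) by simp
  have uf: "cmod (cinner (u g) (f h)) \<le> C * D" if "g \<in> carrier G" "h \<in> carrier G" for g h
    using cmod_cinner_le[of "u g" "f h"] mult_mono[OF C(2)[OF that(1)] D(2)[OF that(2)]] C(1) by simp

  \<comment> \<open>Permissibility gives convergence; the value of the limit comes from invariance.
    Translating \<open>g\<close> by \<open>y\<close> in the correlation that defines
    \<open>\<gamma>\<close> at \<open>y^-1 x\<close> gives the correlation of the translates of
    \<open>u\<close> by \<open>x\<close> and \<open>y\<close>, and the translation error vanishes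
    along the subsequence too.\<close>
  have lim_B: "(\<lambda>q. average (F (N q)) (\<lambda>g. cinner (u (g \<otimes>\<^bsub>G\<^esub> x)) (u (g \<otimes>\<^bsub>G\<^esub> y))))
      \<longlonglongrightarrow> \<gamma> (inv\<^bsub>G\<^esub> y \<otimes>\<^bsub>G\<^esub> x)" if xy: "x \<in> carrier G" "y \<in> carrier G" for x y
  proof -
    let ?\<psi> = "\<lambda>g. cinner (u (g \<otimes>\<^bsub>G\<^esub> (inv\<^bsub>G\<^esub> y \<otimes>\<^bsub>G\<^esub> x))) (u g)"
    have "(\<lambda>n. average (F n) (\<lambda>g. ?\<psi> (g \<otimes>\<^bsub>G\<^esub> y)) - average (F n) ?\<psi>) \<longlonglongrightarrow> 0"
      by (rule right_Folner_average_translate[OF is_group F xy(2), where C = "C * C"])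
        (use xy in \<open>auto intro!: uu\<close>)
    from tendsto_add[OF LIMSEQ_subseq_LIMSEQ[OF this N]
        lim_\<gamma>[OF m_closed[OF inv_closed[OF xy(2)] xy(1)]]]
    have "(\<lambda>q. average (F (N q)) (\<lambda>g. ?\<psi> (g \<otimes>\<^bsub>G\<^esub> y))) \<longlonglongrightarrow> \<gamma> (inv\<^bsub>G\<^esub> y \<otimes>\<^bsub>G\<^esub> x)"
      by (simp add: o_def)
    moreover have "average (F (N q)) (\<lambda>g. ?\<psi> (g \<otimes>\<^bsub>G\<^esub> y))
        = average (F (N q)) (\<lambda>g. cinner (u (g \<otimes>\<^bsub>G\<^esub> x)) (u (g \<otimes>\<^bsub>G\<^esub> y)))" for q
    proof (rule average_cong)
      fix g assume "g \<in> F (N q)"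
      then have g: "g \<in> carrier G" by (rule F_carrier)
      have "y \<otimes>\<^bsub>G\<^esub> (inv\<^bsub>G\<^esub> y \<otimes>\<^bsub>G\<^esub> x) = x"
        using xy by (simp flip: m_assoc)
      then show "?\<psi> (g \<otimes>\<^bsub>G\<^esub> y) = cinner (u (g \<otimes>\<^bsub>G\<^esub> x)) (u (g \<otimes>\<^bsub>G\<^esub> y))"
        using xy g by (simp add: m_assoc)
    qed
    ultimately show ?thesis by simp
  qed
  \<comment> \<open>Exchanging the two translates conjugates the limit. This is needed because the
    separated points are controlled only for \<open>i < j\<close>.\<close>
  have \<gamma>_sym: "cmod (\<gamma> (inv\<^bsub>G\<^esub> x \<otimes>\<^bsub>G\<^esub> y)) = cmod (\<gamma> (inv\<^bsub>G\<^esub> y \<otimes>\<^bsub>G\<^esub> x))"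
    if xy: "x \<in> carrier G" "y \<in> carrier G" for x y
  proof -
    have "(\<lambda>q. cnj (average (F (N q)) (\<lambda>g. cinner (u (g \<otimes>\<^bsub>G\<^esub> x)) (u (g \<otimes>\<^bsub>G\<^esub> y)))))
        \<longlonglongrightarrow> cnj (\<gamma> (inv\<^bsub>G\<^esub> y \<otimes>\<^bsub>G\<^esub> x))"
      by (intro tendsto_cnj lim_B xy)
    then have "(\<lambda>q. average (F (N q)) (\<lambda>g. cinner (u (g \<otimes>\<^bsub>G\<^esub> y)) (u (g \<otimes>\<^bsub>G\<^esub> x))))
        \<longlonglongrightarrow> cnj (\<gamma> (inv\<^bsub>G\<^esub> y \<otimes>\<^bsub>G\<^esub> x))"
      by (simp flip: average_cnj cinner_commute)
    from LIMSEQ_unique[OF this lim_B[OF xy(2,1)]] show ?thesis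
      by (metis complex_mod_cnj)
  qed
  have \<gamma>_le: "cmod (\<gamma> h) \<le> C * C" if "h \<in> carrier G" for h
  proof (rule LIMSEQ_le_const2[OF tendsto_norm[OF lim_\<gamma>[OF that]]], intro exI allI impI)
    show "cmod (average (F (N q)) (\<lambda>g. cinner (u (g \<otimes>\<^bsub>G\<^esub> h)) (u g))) \<le> C * C" for q
      using F' that by (intro norm_average_le_const uu) (auto simp: F_carrier)
  qed
  have c_le: "cmod (c h) \<le> C * D" if "h \<in> carrier G" for h
  proof (rule LIMSEQ_le_const2[OF tendsto_norm[OF lim_c[OF that]]], intro exI allI impI)
    show "cmod (average (F (N q)) (\<lambda>g. cinner (u (g \<otimes>\<^bsub>G\<^esub> h)) (f g))) \<le> C * D" for q
      using F' that by (intro norm_average_le_const uf) (auto simp: F_carrier)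
  qed

  \<comment> \<open>The averages of \<open>cmod (\<gamma> h)\<close> and the limsup
    hypothesis\<close>
  define L where "L h = limsup (\<lambda>M. ereal (cmod
      (average (F M) (\<lambda>g. cinner (u (g \<otimes>\<^bsub>G\<^esub> h)) (u g)))))" for h
  \<comment> \<open>A limit along a subsequence is at most the limsup of the whole sequence. This
    transfers the hypothesis on \<open>L\<close> to \<open>\<gamma>\<close>.\<close>
  have \<gamma>_le_L: "ereal (cmod (\<gamma> h)) \<le> L h" if "h \<in> carrier G" for h
  proof -
    let ?s = "\<lambda>M. ereal (cmod (average (F M) (\<lambda>g. cinner (u (g \<otimes>\<^bsub>G\<^esub> h)) (u g))))"
    have "(?s \<circ> N) \<longlonglongrightarrow> ereal (cmod (\<gamma> h))"
      using lim_\<gamma>[OF that] by (auto simp: o_def intro!: tendsto_norm)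
    then have "limsup (?s \<circ> N) = ereal (cmod (\<gamma> h))"
      by (intro lim_imp_Limsup) auto
    then show ?thesis
      using limsup_subseq_mono[OF N, of ?s] by (simp add: L_def)
  qed
  have "(\<lambda>n. ereal (average (F n) (\<lambda>h. cmod (\<gamma> h)))) \<longlonglongrightarrow> 0"
  proof (rule tendsto_sandwich[OF _ _ tendsto_const])
    show "(\<lambda>n. (\<Sum>h\<in>F n. L h) / ereal (real (card (F n)))) \<longlonglongrightarrow> 0"
      using assms(8) by (simp add: L_def)
    have "average (F n) (\<lambda>h. cmod (\<gamma> h)) \<ge> 0" for n
      by (simp add: average_def sum_nonneg)
    then show "\<forall>\<^sub>F n in sequentially. 0 \<le> ereal (average (F n) (\<lambda>h. cmod (\<gamma> h)))"
      by simp
    have "ereal (average (F n) (\<lambda>h. cmod (\<gamma> h))) \<le> (\<Sum>h\<in>F n. L h) / ereal (real (card (F n)))" for n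
    proof -
      have "card (F n) \<noteq> 0" using F' by simp
      then have "ereal (average (F n) (\<lambda>h. cmod (\<gamma> h)))
          = (\<Sum>h\<in>F n. ereal (cmod (\<gamma> h))) / ereal (real (card (F n)))"
        by (simp add: average_def)
      also have "\<dots> \<le> (\<Sum>h\<in>F n. L h) / ereal (real (card (F n)))"
        using F' \<open>card (F n) \<noteq> 0\<close> by (intro ereal_divide_right_mono sum_mono \<gamma>_le_L) (auto simp: card_gt_0_iff)
      finally show ?thesis .
    qed
    then show "\<forall>\<^sub>F n in sequentially. ereal (average (F n) (\<lambda>h. cmod (\<gamma> h)))
        \<le> (\<Sum>h\<in>F n. L h) / ereal (real (card (F n)))"
      by simp
  qed
  then have avg_\<gamma>: "(\<lambda>n. average (F n) (\<lambda>h. cmod (\<gamma> h))) \<longlonglongrightarrow> 0"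
    by (simp add: zero_ereal_def)

  \<comment> \<open>The averages of \<open>cmod (c h)\<close>, by almost orthogonal translates of
    \<open>u\<close>\<close>
  have "(\<lambda>n. average (F n) (\<lambda>h. cmod (c h))) \<longlonglongrightarrow> 0"
  proof (rule right_Folner_average_tendsto_0[OF is_group F norm_ge_zero c_le])
    fix \<epsilon> :: real assume \<epsilon>: "0 < \<epsilon>"
    \<comment> \<open>Chosen so that the \<open>\<delta>\<close> part of the Gram matrix contributes
      at most half of the target \<open>(m \<epsilon>)^2\<close>. Adding 1 to the square of
      \<open>D\<close> keeps the denominator positive when \<open>D = 0\<close>.\<close>
    define \<delta> where "\<delta> = \<epsilon>\<^sup>2 / (2 * (D\<^sup>2 + 1))"
    have \<delta>: "0 < \<delta>" "D\<^sup>2 * \<delta> \<le> \<epsilon>\<^sup>2 / 2"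
    proof -
      have "0 < D\<^sup>2 + 1" by (simp add: add_nonneg_pos)
      then show "0 < \<delta>" "D\<^sup>2 * \<delta> \<le> \<epsilon>\<^sup>2 / 2"
        using \<epsilon> by (auto simp: \<delta>_def field_simps)
    qed
    \<comment> \<open>There are only \<open>m\<close> diagonal entries, each at most
      \<open>C * C\<close>, against a target of order \<open>m^2\<close>; for \<open>m\<close> this
      large they use at most the other half.\<close>
    obtain m :: nat where "real m > D\<^sup>2 * (C * C) / (\<epsilon>\<^sup>2 / 2)"
      using reals_Archimedean2 by blast
    moreover have "0 \<le> D\<^sup>2 * (C * C) / (\<epsilon>\<^sup>2 / 2)"
      by simp
    ultimately have m: "0 < real m" "D\<^sup>2 * (C * C) \<le> real m * (\<epsilon>\<^sup>2 / 2)"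
      using \<epsilon> by (linarith, simp add: divide_less_eq)
    have "\<exists>k. (\<forall>i<m. k i \<in> carrier G) \<and>
        (\<forall>j<m. \<forall>i<j. cmod (\<gamma> (inv\<^bsub>G\<^esub> k j \<otimes>\<^bsub>G\<^esub> k i)) < \<delta>)"
      by (rule right_Folner_exists_separated[OF is_group F _ \<gamma>_le avg_\<gamma> \<delta>(1)]) auto
    then obtain k where k: "\<And>i. i < m \<Longrightarrow> k i \<in> carrier G"
      and sep: "\<And>i j. j < m \<Longrightarrow> i < j \<Longrightarrow> cmod (\<gamma> (inv\<^bsub>G\<^esub> k j \<otimes>\<^bsub>G\<^esub> k i)) < \<delta>"
      by auto
    \<comment> \<open>Allowing \<open>\<delta>\<close> on the diagonal as well gives one bound for
      all entries, which sums to \<open>m * (C * C) + m^2 * \<delta>\<close>.\<close>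
    have sep': "cmod (\<gamma> (inv\<^bsub>G\<^esub> k j \<otimes>\<^bsub>G\<^esub> k i)) \<le> (if i = j then C * C else 0) + \<delta>"
      if "i < m" "j < m" for i j
    proof (cases i j rule: linorder_cases)
      case less
      then show ?thesis using sep[of j i] that by simp
    next
      case equal
      then show ?thesis using \<gamma>_le[of "inv\<^bsub>G\<^esub> k j \<otimes>\<^bsub>G\<^esub> k i"] k that \<delta>(1) by force
    next
      case greater
      then show ?thesis using sep[of i j] \<gamma>_sym[of "k i" "k j"] k that by simp
    qed
    have "(\<Sum>i<m. cmod (c (h \<otimes>\<^bsub>G\<^esub> k i))) \<le> real m * \<epsilon>" if h: "h \<in> carrier G" for h
    proof -
      \<comment> \<open>The factor \<open>h\<close> cancels, so the limiting Gram matrix of the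
        translates by \<open>h k_i\<close> does not depend on \<open>h\<close>. Hence one choice of
        points works for every \<open>h\<close>.\<close>
      have hk: "inv\<^bsub>G\<^esub> (h \<otimes>\<^bsub>G\<^esub> k j) \<otimes>\<^bsub>G\<^esub> (h \<otimes>\<^bsub>G\<^esub> k i) = inv\<^bsub>G\<^esub> k j \<otimes>\<^bsub>G\<^esub> k i"
        if "i < m" "j < m" for i j
      proof -
        have "inv\<^bsub>G\<^esub> h \<otimes>\<^bsub>G\<^esub> (h \<otimes>\<^bsub>G\<^esub> k i) = k i"
          using h k[OF that(1)] by (simp flip: m_assoc)
        then show ?thesis
          using h k that by (simp add: inv_mult_group m_assoc)
      qed
      have "(\<Sum>i<m. cmod (c (h \<otimes>\<^bsub>G\<^esub> k i)))\<^sup>2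
          \<le> D\<^sup>2 * (\<Sum>i<m. \<Sum>j<m. cmod (\<gamma> (inv\<^bsub>G\<^esub> (h \<otimes>\<^bsub>G\<^esub> k j) \<otimes>\<^bsub>G\<^esub> (h \<otimes>\<^bsub>G\<^esub> k i))))"
        using h k
        by (intro bessel_average_le[where E = "\<lambda>q. F (N q)" and f = f
              and x = "\<lambda>i g. u (g \<otimes>\<^bsub>G\<^esub> (h \<otimes>\<^bsub>G\<^esub> k i))"] lim_c lim_B D) (auto simp: F_carrier)
      also have "\<dots> \<le> D\<^sup>2 * (\<Sum>i<m. \<Sum>j<m. (if i = j then C * C else 0) + \<delta>)"
        by (intro mult_left_mono sum_mono) (auto simp: hk sep')
      also have "\<dots> = real m * (D\<^sup>2 * (C * C)) + (real m)\<^sup>2 * (D\<^sup>2 * \<delta>)"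
        by (simp add: sum.distrib sum.delta' algebra_simps power2_eq_square)
      also have "\<dots> \<le> real m * (real m * (\<epsilon>\<^sup>2 / 2)) + (real m)\<^sup>2 * (\<epsilon>\<^sup>2 / 2)"
        using m \<delta> by (intro add_mono mult_left_mono) auto
      also have "\<dots> = (real m * \<epsilon>)\<^sup>2"
        by (simp add: power2_eq_square algebra_simps)
      finally show ?thesis
        by (rule power2_le_imp_le) (use \<epsilon> in simp)
    qed
    then show "\<exists>m k. 0 < m \<and> (\<forall>i<m. k i \<in> carrier G) \<and>
        (\<forall>h\<in>carrier G. (\<Sum>i<m. cmod (c (h \<otimes>\<^bsub>G\<^esub> k i))) \<le> real m * \<epsilon>)"
      using m k by (intro exI[of _ m] exI[of _ k]) auto
  qed
  then show "(\<lambda>n. average (F n) (\<lambda>h. cmod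
      (lim (\<lambda>q. average (F (N q)) (\<lambda>g. cinner (u (g \<otimes>\<^bsub>G\<^esub> h)) (f g)))))) \<longlonglongrightarrow> 0"
    by (simp add: c_def)
qed

end
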